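(* Let $X$ be a compact triangulable topological space and $f:X\to\mathbb{R}^n$ a continuous function. If $(\bar u,\bar v)\in D_n^+$ is a proper cornerpoint of $\beta_f$, then both $\bar u$ and $\bar v$ are homological critical values for $f$. Moreover, if $(\bar u,\infty)$, with $\bar u\in\mathbb{R}^n$, is a cornerpoint at infinity of $\beta_f$, then $\bar u$ is a homological critical value for $f$.
   Context: For $u,v\in\mathbb{R}^n$, $u\preceq v$ (resp. $u\prec v$, $u\succeq v$, $u\succ v$) means $u_i\le v_i$ (resp. $u_i<v_i$, $u_i\ge v_i$, $u_i>v_i$) for all $i=1,\dots,n$. $\|\cdot\|_\infty$ is the max-norm. $D_n^+=\{(u,v)\in\mathbb{R}^n\times\mathbb{R}^n: u\prec v\}$ and $D_n^*=D_n^+\cup\{(u,\infty):u\in\mathbb{R}^n\}$. Fix a field $\mathbb{K}$. $\check H_k$ is $k$th Čech homology with coefficients in $\mathbb{K}$. For $u\in\mathbb{R}^n$, $X\langle f\preceq u\rangle=\{x\in X:f(x)\preceq u\}$; for $u\preceq v$, $\iota_k^{u,v}:\check H_k(X\langle f\preceq u\rangle)\to\check H_k(X\langle f\preceq v\rangle)$ is the map induced by inclusion. For a fixed homology degree $k\in\mathbb{Z}$ (omitted from the notation), $\beta_f:D_n^+\to\mathbb{N}$, $\beta_f(u,v)=\operatorname{rank}\iota_k^{u,v}$ (which is finite). Multiplicity of $(u,v)\in D_n^+$: $\mu_f(u,v)$ is the minimum, over all $\vec e\in\mathbb{R}^n$ with $\vec e\succ0$ and $u+\vec e\prec v-\vec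 e$, of $$\beta_f(u+\vec e,v-\vec e)-\beta_f(u-\vec e,v-\vec e)-\beta_f(u+\vec e,v+\vec e)+\beta_f(u-\vec e,v+\vec e).$$ Multiplicity of $(u,\infty)\in D_n^*$: $\mu_f(u,\infty)$ is the minimum, over all $\vec e\succ0$ and all $v\in\mathbb{R}^n$ with $u+\vec e\prec v$, of $\beta_f(u+\vec e,v)-\beta_f(u-\vec e,v)$. Both are finite non-negative integers. A point $(u,v)\in D_n^+$ with $\mu_f(u,v)>0$ is a proper cornerpoint of $\beta_f$; a point $(u,\infty)$ with $\mu_f(u,\infty)>0$ is a cornerpoint at infinity of $\beta_f$. $u\in\mathbb{R}^n$ is a homological critical value for $f$ if there exists an integer $k$ such that, for all sufficiently small real $\varepsilon>0$, there are $u',u''\in\mathbb{R}^n$ with $u'\preceq u\preceq u''$, $\|u'-u\|_\infty<\varepsilon$, $\|u''-u\|_\infty<\varepsilon$, such that $\iota_k^{u',u''}:\check H_k(X\langle f\preceq u'\rangle)\to\check H_k(X\langle f\preceq u''\rangle)$ is not an isomorphism. *)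

theory Defs
  imports
    "HOL-Analysis.Analysis"
    "HOL-Algebra.Module"
    "HOL-Library.Poly_Mapping"
    "HOL-Library.Set_Algebras"
begin

section \<open>Vector spaces over a field type\<close>

text \<open>
  The field of coefficients is a type \<open>'k::field\<close>; a vector space over it is a record of type
  \<open>('k, 'a) module\<close>, whose ring fields \<open>mult\<close> and \<open>one\<close> are irrelevant (and left undefined below).
\<close>

definition lin_independent :: "('k::field, 'a) module \<Rightarrow> 'a set \<Rightarrow> bool" where
  "lin_independent M S \<longleftrightarrow> finite S \<and> S \<subseteq> carrier M \<and>
     (\<forall>c :: 'a \<Rightarrow> 'k. (\<Oplus>\<^bsub>M\<^esub>x\<in>S. c x \<odot>\<^bsub>M\<^esub> x) = \<zero>\<^bsub>M\<^esub> \<longrightarrow> (\<forall>x\<in>S. c x = 0))"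

text \<open>
  The dimension of a finite-dimensional subspace \<open>A\<close> of \<open>M\<close>. The supremum is that of \<^typ>\<open>nat\<close>, so
  the value carries no information if \<open>A\<close> is infinite-dimensional.
\<close>

definition subspace_dim :: "('k::field, 'a) module \<Rightarrow> 'a set \<Rightarrow> nat" where
  "subspace_dim M A = Sup {card S |S. S \<subseteq> A \<and> lin_independent M S}"

definition linear_rank :: "('k::field, 'a) module \<Rightarrow> ('k, 'b) module \<Rightarrow> ('a \<Rightarrow> 'b) \<Rightarrow> nat" where
  "linear_rank M N T = subspace_dim N (T ` carrier M)"

definition linear_iso :: "('k::field, 'a) module \<Rightarrow> ('k, 'b) module \<Rightarrow> ('a \<Rightarrow> 'b) \<Rightarrow> bool" where
  "linear_iso M N T \<longleftrightarrow> bij_betw T (carrier M) (carrier N) \<and>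
     (\<forall>x\<in>carrier M. \<forall>y\<in>carrier M. T (x \<oplus>\<^bsub>M\<^esub> y) = T x \<oplus>\<^bsub>N\<^esub> T y) \<and>
     (\<forall>a. \<forall>x\<in>carrier M. T (a \<odot>\<^bsub>M\<^esub> x) = a \<odot>\<^bsub>N\<^esub> T x)"


section \<open>Simplicial homology of an abstract simplicial complex\<close>

text \<open>
  A complex is the set of its (nonempty, finite) simplices. Its homology is computed from the
  ordered chain complex: a generator in degree \<open>k\<close> is a list of \<open>k + 1\<close> vertices, possibly with
  repetitions, whose entries span a simplex. The complex is not augmented, and since no simplex
  is empty the chain groups vanish in negative degrees.
\<close>

type_synonym ('v, 'k) chain = "'v list \<Rightarrow>\<^sub>0 'k"

definition chain_scale :: "'k::field \<Rightarrow> ('v, 'k) chain \<Rightarrow> ('v, 'k) chain" where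
  "chain_scale a c = Poly_Mapping.map ((*) a) c"

definition chain_extend :: "('v list \<Rightarrow> ('w, 'k) chain) \<Rightarrow> ('v, 'k::field) chain \<Rightarrow> ('w, 'k) chain" where
  "chain_extend b c = (\<Sum>\<sigma>\<in>Poly_Mapping.keys c. chain_scale (Poly_Mapping.lookup c \<sigma>) (b \<sigma>))"

definition chains :: "'v set set \<Rightarrow> int \<Rightarrow> ('v, 'k::field) chain set" where
  "chains K k = {c. \<forall>\<sigma>\<in>Poly_Mapping.keys c. int (length \<sigma>) = k + 1 \<and> set \<sigma> \<in> K}"

definition simplex_boundary :: "'v list \<Rightarrow> ('v, 'k::field) chain" where
  "simplex_boundary \<sigma> =
     (if length \<sigma> \<le> 1 then 0
      else (\<Sum>i<length \<sigma>. Poly_Mapping.single (take i \<sigma> @ drop (Suc i) \<sigma>) ((- 1) ^ i)))"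

definition chain_boundary :: "('v, 'k::field) chain \<Rightarrow> ('v, 'k) chain" where
  "chain_boundary = chain_extend simplex_boundary"

definition cycles :: "'v set set \<Rightarrow> int \<Rightarrow> ('v, 'k::field) chain set" where
  "cycles K k = {c \<in> chains K k. chain_boundary c = 0}"

definition boundaries :: "'v set set \<Rightarrow> int \<Rightarrow> ('v, 'k::field) chain set" where
  "boundaries K k = chain_boundary ` chains K (k + 1)"

text \<open>Homology classes are cosets, so the sum of two of them is their elementwise sum.\<close>

definition homology_class :: "'v set set \<Rightarrow> int \<Rightarrow> ('v, 'k::field) chain \<Rightarrow> ('v, 'k) chain set" where
  "homology_class K k z = z +o boundaries K k"

definition simplicial_homology ::
    "'v set set \<Rightarrow> int \<Rightarrow> ('k::field, ('v, 'k) chain set) module" where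
  "simplicial_homology K k =
     \<lparr>carrier = homology_class K k ` cycles K k,
      mult = undefined,
      one = undefined,
      zero = boundaries K k,
      add = (\<lambda>A B. A + B),
      smult = (\<lambda>a A. \<Union>z\<in>A. homology_class K k (chain_scale a z))\<rparr>"

text \<open>The map induced by a simplicial map \<open>p\<close> into the complex \<open>L\<close>, by pushing representatives forward.\<close>

definition simplicial_induced ::
    "'w set set \<Rightarrow> int \<Rightarrow> ('v \<Rightarrow> 'w) \<Rightarrow> ('v, 'k::field) chain set \<Rightarrow> ('w, 'k) chain set" where
  "simplicial_induced L k p A =
     (\<Union>z\<in>A. homology_class L k (chain_extend (\<lambda>\<sigma>. Poly_Mapping.single (map p \<sigma>) 1) z))"


section \<open>Cech homology\<close>

definition open_covers :: "'x topology \<Rightarrow> 'x set set set" where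
  "open_covers X = {\<U>. (\<forall>U\<in>\<U>. openin X U) \<and> \<Union>\<U> = topspace X}"

definition nerve :: "'x set set \<Rightarrow> 'x set set set" where
  "nerve \<U> = {s. s \<subseteq> \<U> \<and> finite s \<and> s \<noteq> {} \<and> \<Inter>s \<noteq> {}}"

definition refinement_projection :: "'x set set \<Rightarrow> 'x set set \<Rightarrow> ('x set \<Rightarrow> 'x set) \<Rightarrow> bool" where
  "refinement_projection \<V> \<U> p \<longleftrightarrow> (\<forall>V\<in>\<V>. p V \<in> \<U> \<and> V \<subseteq> p V)"

text \<open>
  The inverse limit of the homology of the nerves over all open covers directed by refinement.
  Any two projections between the same covers are contiguous, hence induce the same bonding map;
  quantifying over all of them avoids a choice.
\<close>

definition cech_homology ::
    "'x topology \<Rightarrow> int \<Rightarrow> ('k::field, 'x set set \<Rightarrow> ('x set, 'k) chain set) module" where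
  "cech_homology X k =
     \<lparr>carrier =
        {h \<in> (\<Pi>\<^sub>E \<U>\<in>open_covers X. carrier (simplicial_homology (nerve \<U>) k)).
           \<forall>\<U>\<in>open_covers X. \<forall>\<V>\<in>open_covers X. \<forall>p. refinement_projection \<V> \<U> p \<longrightarrow>
             simplicial_induced (nerve \<U>) k p (h \<V>) = h \<U>},
      mult = undefined,
      one = undefined,
      zero = (\<lambda>\<U>\<in>open_covers X. \<zero>\<^bsub>simplicial_homology (nerve \<U>) k\<^esub>),
      add = (\<lambda>h h'. \<lambda>\<U>\<in>open_covers X. h \<U> \<oplus>\<^bsub>simplicial_homology (nerve \<U>) k\<^esub> h' \<U>),
      smult = (\<lambda>a h. \<lambda>\<U>\<in>open_covers X. a \<odot>\<^bsub>simplicial_homology (nerve \<U>) k\<^esub> h \<U>)\<rparr>"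

text \<open>
  The map induced by a continuous \<open>g\<close> from \<open>X\<close> to \<open>Y\<close>: its component at a cover \<open>\<U>\<close> of \<open>Y\<close> is the
  image of the component at the cover of \<open>X\<close> by the preimages of the members of \<open>\<U>\<close>. The vertex map
  between the nerves sends a preimage to some member of \<open>\<U>\<close> of which it is the preimage; different
  choices are contiguous.
\<close>

definition cech_induced ::
    "'x topology \<Rightarrow> 'y topology \<Rightarrow> int \<Rightarrow> ('x \<Rightarrow> 'y) \<Rightarrow>
     ('x set set \<Rightarrow> ('x set, 'k::field) chain set) \<Rightarrow> ('y set set \<Rightarrow> ('y set, 'k) chain set)" where
  "cech_induced X Y k g h =
     (let pre = (\<lambda>U. {x \<in> topspace X. g x \<in> U})
      in (\<lambda>\<U>\<in>open_covers Y. simplicial_induced (nerve \<U>) k (inv_into \<U> pre) (h (pre ` \<U>))))"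


section \<open>Multidimensional persistent homology\<close>

text \<open>
  The relation \<open>u \<preceq> v\<close> is the library's \<open>u \<le> v\<close> on \<^typ>\<open>real ^ 'n\<close>. The library's
  \<open>u < v\<close> means \<open>u \<le> v \<and> u \<noteq> v\<close>, hence a separate relation for the strict componentwise order.
\<close>

definition vec_less :: "real ^ 'n \<Rightarrow> real ^ 'n \<Rightarrow> bool" (infix \<open>\<prec>\<close> 50) where
  "u \<prec> v \<longleftrightarrow> (\<forall>i. u $ i < v $ i)"

definition sublevel :: "'x topology \<Rightarrow> ('x \<Rightarrow> real ^ 'n) \<Rightarrow> real ^ 'n \<Rightarrow> 'x topology" where
  "sublevel X f u = subtopology X {x \<in> topspace X. f x \<le> u}"

definition sublevel_homology ::
    "'k::field itself \<Rightarrow> int \<Rightarrow> 'x topology \<Rightarrow> ('x \<Rightarrow> real ^ 'n) \<Rightarrow> real ^ 'n \<Rightarrow>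
     ('k, 'x set set \<Rightarrow> ('x set, 'k) chain set) module" where
  "sublevel_homology K k X f u = cech_homology (sublevel X f u) k"

definition inclusion_map ::
    "'k::field itself \<Rightarrow> int \<Rightarrow> 'x topology \<Rightarrow> ('x \<Rightarrow> real ^ 'n) \<Rightarrow> real ^ 'n \<Rightarrow> real ^ 'n \<Rightarrow>
     ('x set set \<Rightarrow> ('x set, 'k) chain set) \<Rightarrow> ('x set set \<Rightarrow> ('x set, 'k) chain set)" where
  "inclusion_map K k X f u v = cech_induced (sublevel X f u) (sublevel X f v) k (\<lambda>x. x)"

definition persistent_betti ::
    "'k::field itself \<Rightarrow> int \<Rightarrow> 'x topology \<Rightarrow> ('x \<Rightarrow> real ^ 'n) \<Rightarrow> real ^ 'n \<Rightarrow> real ^ 'n \<Rightarrow> nat" where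
  "persistent_betti K k X f u v =
     linear_rank (sublevel_homology K k X f u) (sublevel_homology K k X f v)
       (inclusion_map K k X f u v)"

text \<open>
  The minima are taken in \<^typ>\<open>nat\<close>: for a continuous function on a compact triangulable space the
  ranks are finite and all the alternating sums below are nonnegative.
\<close>

definition multiplicity_proper ::
    "'k::field itself \<Rightarrow> int \<Rightarrow> 'x topology \<Rightarrow> ('x \<Rightarrow> real ^ 'n) \<Rightarrow> real ^ 'n \<Rightarrow> real ^ 'n \<Rightarrow> nat" where
  "multiplicity_proper K k X f u v =
     (let \<beta> = (\<lambda>s t. int (persistent_betti K k X f s t))
      in LEAST m. \<exists>e. 0 \<prec> e \<and> u + e \<prec> v - e \<and>
           int m = \<beta> (u + e) (v - e) - \<beta> (u - e) (v - e) - \<beta> (u + e) (v + e) + \<beta> (u - e) (v + e))"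

definition multiplicity_infinity ::
    "'k::field itself \<Rightarrow> int \<Rightarrow> 'x topology \<Rightarrow> ('x \<Rightarrow> real ^ 'n) \<Rightarrow> real ^ 'n \<Rightarrow> nat" where
  "multiplicity_infinity K k X f u =
     (let \<beta> = (\<lambda>s t. int (persistent_betti K k X f s t))
      in LEAST m. \<exists>e v. 0 \<prec> e \<and> u + e \<prec> v \<and> int m = \<beta> (u + e) v - \<beta> (u - e) v)"

definition proper_cornerpoint ::
    "'k::field itself \<Rightarrow> int \<Rightarrow> 'x topology \<Rightarrow> ('x \<Rightarrow> real ^ 'n) \<Rightarrow> real ^ 'n \<Rightarrow> real ^ 'n \<Rightarrow> bool" where
  "proper_cornerpoint K k X f u v \<longleftrightarrow> u \<prec> v \<and> multiplicity_proper K k X f u v > 0"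

definition cornerpoint_at_infinity ::
    "'k::field itself \<Rightarrow> int \<Rightarrow> 'x topology \<Rightarrow> ('x \<Rightarrow> real ^ 'n) \<Rightarrow> real ^ 'n \<Rightarrow> bool" where
  "cornerpoint_at_infinity K k X f u \<longleftrightarrow> multiplicity_infinity K k X f u > 0"

definition homological_critical_value ::
    "'k::field itself \<Rightarrow> 'x topology \<Rightarrow> ('x \<Rightarrow> real ^ 'n) \<Rightarrow> real ^ 'n \<Rightarrow> bool" where
  "homological_critical_value K X f u \<longleftrightarrow>
     (\<exists>k::int. \<forall>\<^sub>F \<epsilon> in at_right (0::real).
        \<exists>u' u''. u' \<le> u \<and> u \<le> u'' \<and> infnorm (u' - u) < \<epsilon> \<and> infnorm (u'' - u) < \<epsilon> \<and>
          \<not> linear_iso (sublevel_homology K k X f u') (sublevel_homology K k X f u'')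
               (inclusion_map K k X f u' u''))"

end

theory Submission
  imports Defs
begin

text \<open>
  Suppose that \<open>u\<close> is not a homological critical value. Then, for all sufficiently small constant
  vectors \<open>e \<succ> 0\<close>, the map from the homology of the sublevel at \<open>u - e\<close> to that at \<open>u + e\<close> is an
  isomorphism. A sublevel map out of \<open>u - e\<close> that ends above \<open>u + e\<close> factors through this
  isomorphism, so it has the same image as the map out of \<open>u + e\<close>
  (\<open>persistent_betti_iso_left\<close>); a map into \<open>u + e\<close> that starts below \<open>u - e\<close> is the map into
  \<open>u - e\<close> followed by it, and an isomorphism preserves the dimension of an image
  (\<open>persistent_betti_iso_right\<close>). Hence, as soon as \<open>e\<close> is also small compared with \<open>v - u\<close>, the four
  Betti numbers in the multiplicity of \<open>(u, v)\<close> cancel in pairs if \<open>u\<close> or \<open>v\<close> is not critical. One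
  of the numbers over which the minimum is taken is then \<open>0\<close>, so the multiplicity is \<open>0\<close>; the same
  argument applies to \<open>(u, \<infinity>)\<close>.

  The substance is that the sublevel maps compose (\<open>cech_induced_compose\<close>) and send elements of the
  inverse limit to such elements (\<open>cech_induced_closed\<close>). The map induced on Cech homology involves a
  choice of vertex maps between nerves, and the composite of two choices is only contiguous to the
  third. That contiguous vertex maps agree on homology is \<open>contiguous_homology_class\<close>, proved by the
  chain homotopy \<open>prism\<close>; \<open>cech_induced_cover_map\<close> draws the conclusion that the induced map may be
  computed with any cover of the source and any vertex map that represents it.
\<close>


section \<open>Linear extension on chain groups\<close>

lemma lookup_chain_scale [simp]: "Poly_Mapping.lookup (chain_scale a c) \<sigma> = a * Poly_Mapping.lookup c \<sigma>"
  by (simp add: chain_scale_def Poly_Mapping.map.rep_eq when_def)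

lemma chain_scale_zero_left [simp]: "chain_scale 0 c = 0"
  and chain_scale_zero_right [simp]: "chain_scale a 0 = 0"
  and chain_scale_one [simp]: "chain_scale 1 c = c"
  and chain_scale_add_left: "chain_scale (a + b) c = chain_scale a c + chain_scale b c"
  and chain_scale_add_right: "chain_scale a (c + d) = chain_scale a c + chain_scale a d"
  and chain_scale_diff_right: "chain_scale a (c - d) = chain_scale a c - chain_scale a d"
  and chain_scale_scale: "chain_scale a (chain_scale b c) = chain_scale (a * b) c"
  by (rule poly_mapping_eqI; simp add: lookup_add lookup_minus algebra_simps)+

lemma chain_scale_sum: "chain_scale a (sum f S) = (\<Sum>x\<in>S. chain_scale a (f x))"
  by (induction S rule: infinite_finite_induct) (simp_all add: chain_scale_add_right)

lemma keys_chain_scale: "Poly_Mapping.keys (chain_scale a c) \<subseteq> Poly_Mapping.keys c"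
  by (auto simp: in_keys_iff)

lemma chain_extend_superset:
  assumes "finite S" "Poly_Mapping.keys c \<subseteq> S"
  shows "chain_extend b c = (\<Sum>\<sigma>\<in>S. chain_scale (Poly_Mapping.lookup c \<sigma>) (b \<sigma>))"
  unfolding chain_extend_def
  by (rule sum.mono_neutral_left) (use assms in \<open>auto simp: in_keys_iff\<close>)

lemma chain_extend_zero [simp]: "chain_extend b 0 = 0"
  by (simp add: chain_extend_def)

lemma chain_extend_single [simp]:
  "chain_extend b (Poly_Mapping.single \<sigma> a) = chain_scale a (b \<sigma>)"
  by (subst chain_extend_superset[of "{\<sigma>}"]) (auto simp: lookup_single)

lemma chain_extend_add: "chain_extend b (c + d) = chain_extend b c + chain_extend b d"
proof -
  let ?S = "Poly_Mapping.keys c \<union> Poly_Mapping.keys d"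
  have "Poly_Mapping.keys (c + d) \<subseteq> ?S" by (rule keys_add)
  then show ?thesis
    by (simp add: chain_extend_superset[of ?S] lookup_add chain_scale_add_left sum.distrib)
qed

lemma chain_extend_scale: "chain_extend b (chain_scale a c) = chain_scale a (chain_extend b c)"
proof -
  have "chain_extend b (chain_scale a c)
      = (\<Sum>\<sigma>\<in>Poly_Mapping.keys c. chain_scale (Poly_Mapping.lookup (chain_scale a c) \<sigma>) (b \<sigma>))"
    by (rule chain_extend_superset) (simp_all add: keys_chain_scale)
  then show ?thesis
    by (simp add: chain_extend_def chain_scale_sum chain_scale_scale)
qed

lemma chain_extend_diff: "chain_extend b (c - d) = chain_extend b c - chain_extend b d"
  using chain_extend_add[of b "c - d" d] by (simp add: algebra_simps)

lemma chain_extend_sum: "chain_extend b (sum f S) = (\<Sum>x\<in>S. chain_extend b (f x))"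
  by (induction S rule: infinite_finite_induct) (simp_all add: chain_extend_add)

lemma chain_extend_compose:
  "chain_extend b (chain_extend a c) = chain_extend (\<lambda>\<sigma>. chain_extend b (a \<sigma>)) c"
  by (simp add: chain_extend_def[of _ c] chain_extend_sum chain_extend_scale)

lemma chain_extend_add_fun: "chain_extend (\<lambda>\<sigma>. a \<sigma> + b \<sigma>) c = chain_extend a c + chain_extend b c"
  by (simp add: chain_extend_def chain_scale_add_right sum.distrib)

lemma chain_extend_diff_fun: "chain_extend (\<lambda>\<sigma>. a \<sigma> - b \<sigma>) c = chain_extend a c - chain_extend b c"
  by (simp add: chain_extend_def chain_scale_diff_right sum_subtractf)

lemma chain_extend_cong:
  "(\<And>\<sigma>. \<sigma> \<in> Poly_Mapping.keys c \<Longrightarrow> a \<sigma> = b \<sigma>) \<Longrightarrow> chain_extend a c = chain_extend b c"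
  by (simp add: chain_extend_def)

lemma keys_chain_extend:
  "Poly_Mapping.keys (chain_extend b c) \<subseteq> (\<Union>\<sigma>\<in>Poly_Mapping.keys c. Poly_Mapping.keys (b \<sigma>))"
proof -
  have "Poly_Mapping.keys (chain_extend b c)
      \<subseteq> (\<Union>\<sigma>\<in>Poly_Mapping.keys c. Poly_Mapping.keys (chain_scale (Poly_Mapping.lookup c \<sigma>) (b \<sigma>)))"
    unfolding chain_extend_def by (rule keys_sum)
  then show ?thesis using keys_chain_scale by blast
qed


section \<open>Contiguous simplicial maps\<close>

definition push_chain :: "('v \<Rightarrow> 'w) \<Rightarrow> ('v, 'k::field) chain \<Rightarrow> ('w, 'k) chain" where
  "push_chain p = chain_extend (\<lambda>\<sigma>. Poly_Mapping.single (map p \<sigma>) 1)"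

definition cone_chain :: "'v \<Rightarrow> ('v, 'k::field) chain \<Rightarrow> ('v, 'k) chain" where
  "cone_chain v = chain_extend (\<lambda>\<sigma>. Poly_Mapping.single (v # \<sigma>) 1)"

text \<open>
  The boundary in the augmented ordered chain complex, where a single vertex has the empty list as its
  boundary. Written as \<open>\<partial>(v # \<sigma>) = \<sigma> - v # \<partial>\<sigma>\<close>, it lets identities between chain maps be proved by
  induction on the list of vertices; for an edge it needs the
  augmentation to produce the term \<open>- [v]\<close>.
\<close>

fun augmented_boundary :: "'v list \<Rightarrow> ('v, 'k::field) chain" where
  "augmented_boundary [] = 0"
| "augmented_boundary (v # \<sigma>) = Poly_Mapping.single \<sigma> 1 - cone_chain v (augmented_boundary \<sigma>)"

text \<open>
  The alternating sum of the lists \<open>p v\<^sub>0, \<dots>, p v\<^sub>i, q v\<^sub>i, \<dots>, q v\<^sub>k\<close>, the usual triangulation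
  of the prism between the images of a simplex under \<open>p\<close> and \<open>q\<close>.
\<close>

fun prism :: "('v \<Rightarrow> 'w) \<Rightarrow> ('v \<Rightarrow> 'w) \<Rightarrow> 'v list \<Rightarrow> ('w, 'k::field) chain" where
  "prism p q [] = 0"
| "prism p q (v # \<sigma>) =
     Poly_Mapping.single (p v # q v # map q \<sigma>) 1 - cone_chain (p v) (prism p q \<sigma>)"

lemmas chain_linear =
  chain_extend_add chain_extend_diff chain_extend_scale chain_extend_sum

lemma chain_scale_single [simp]:
  "chain_scale a (Poly_Mapping.single \<sigma> b) = Poly_Mapping.single \<sigma> (a * b)"
  by (rule poly_mapping_eqI) (simp add: lookup_single when_def)

text \<open>
  Deleting the head of \<open>v # \<sigma>\<close> gives \<open>\<sigma>\<close>; deleting a later entry is deletion in \<open>\<sigma>\<close> with the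
  index, hence the sign, shifted by one.
\<close>

lemma augmented_boundary_eq_sum:
  "augmented_boundary \<sigma> =
     (\<Sum>i<length \<sigma>. Poly_Mapping.single (take i \<sigma> @ drop (Suc i) \<sigma>) ((- 1 :: 'k::field) ^ i))"
proof (induction \<sigma>)
  case (Cons v \<sigma>)
  show ?case
    by (simp add: Cons.IH sum.lessThan_Suc_shift cone_chain_def chain_extend_sum
        single_uminus sum_negf del: sum.lessThan_Suc)
qed simp

lemma simplex_boundary_eq_augmented:
  "length \<sigma> > 1 \<Longrightarrow> simplex_boundary \<sigma> = augmented_boundary \<sigma>"
  by (simp add: simplex_boundary_def augmented_boundary_eq_sum)

lemma push_cone: "push_chain p (cone_chain v c) = cone_chain (p v) (push_chain p c)"
  by (simp add: push_chain_def cone_chain_def chain_extend_compose)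

lemma augmented_boundary_cone:
  "chain_extend augmented_boundary (cone_chain v c)
     = c - cone_chain v (chain_extend augmented_boundary c)"
proof -
  have *: "chain_extend (\<lambda>\<sigma>. Poly_Mapping.single \<sigma> 1) c = c"
    by (rule poly_mapping_eqI)
       (auto simp: chain_extend_def lookup_sum lookup_single when_def in_keys_iff sum.delta)
  show ?thesis
    by (simp add: cone_chain_def chain_extend_compose chain_extend_diff_fun *)
qed

lemma augmented_boundary_map:
  "augmented_boundary (map p \<sigma>) = (push_chain p (augmented_boundary \<sigma>) :: ('w, 'k::field) chain)"
proof (induction \<sigma>)
  case (Cons v \<sigma>)
  have "push_chain p (augmented_boundary (v # \<sigma>) :: (_, 'k) chain)
     = push_chain p (Poly_Mapping.single \<sigma> 1) - push_chain p (cone_chain v (augmented_boundary \<sigma>))"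
    by (simp add: push_chain_def chain_extend_diff)
  then show ?case by (simp add: Cons.IH push_cone) (simp add: push_chain_def)
qed (simp add: push_chain_def)

lemma prism_cone:
  "chain_extend (prism p q) (cone_chain v c)
     = cone_chain (p v) (cone_chain (q v) (push_chain q c))
       - cone_chain (p v) (chain_extend (prism p q) c)"
  by (simp add: cone_chain_def push_chain_def chain_extend_compose chain_extend_diff_fun)

text \<open>
  For \<open>v # \<sigma>\<close> both terms on the left unfold along the recursions; the prism over \<open>\<sigma>\<close> occurs in them
  with opposite signs, and what is left is evaluated by the cone from \<open>p v\<close> over the formula for \<open>\<sigma>\<close>.
\<close>

lemma prism_homotopy_augmented:
  fixes p q :: "'v \<Rightarrow> 'w"
  shows
  "chain_extend augmented_boundary (prism p q \<sigma>) + chain_extend (prism p q) (augmented_boundary \<sigma>)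
     = Poly_Mapping.single (map q \<sigma>) 1 - Poly_Mapping.single (map p \<sigma>) (1 :: 'k::field)"
proof (induction \<sigma>)
  case (Cons v \<sigma>)
  let ?D = "chain_extend augmented_boundary" and ?Q = "chain_extend (prism p q)"
  let ?d = "augmented_boundary \<sigma> :: (_, 'k) chain"
  have cone: "cone_chain w (c - d) = cone_chain w c - cone_chain w d"
             "cone_chain w (c + d) = cone_chain w c + cone_chain w d"
             "cone_chain w (Poly_Mapping.single \<tau> 1) = (Poly_Mapping.single (w # \<tau>) 1 :: (_, 'k) chain)"
    for w :: 'w and c d :: "('w, 'k) chain" and \<tau>
    by (simp_all add: cone_chain_def chain_linear)
  have IH: "?D (prism p q \<sigma>) = Poly_Mapping.single (map q \<sigma>) 1 - Poly_Mapping.single (map p \<sigma>) 1 - ?Q ?d"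
    using Cons.IH by (simp add: algebra_simps)
  have "?D (prism p q (v # \<sigma>)) = Poly_Mapping.single (q v # map q \<sigma>) 1
          - cone_chain (p v) (Poly_Mapping.single (map q \<sigma>) 1 - cone_chain (q v) (push_chain q ?d))
          - (prism p q \<sigma> - cone_chain (p v) (?D (prism p q \<sigma>)))"
    by (simp add: chain_linear augmented_boundary_cone augmented_boundary_map)
  moreover have "?Q (augmented_boundary (v # \<sigma>)) = prism p q \<sigma>
          - (cone_chain (p v) (cone_chain (q v) (push_chain q ?d)) - cone_chain (p v) (?Q ?d))"
    by (simp add: chain_linear prism_cone)
  ultimately show ?case
    by (simp add: IH cone)
qed simp

lemma keys_prism:
  "\<tau> \<in> Poly_Mapping.keys (prism p q \<sigma> :: (_, 'k::field) chain) \<Longrightarrow>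
     length \<tau> = Suc (length \<sigma>) \<and> \<sigma> \<noteq> [] \<and> set \<tau> \<subseteq> p ` set \<sigma> \<union> q ` set \<sigma>"
proof (induction \<sigma> arbitrary: \<tau>)
  case (Cons v \<sigma>)
  have "\<tau> = p v # q v # map q \<sigma> \<or> \<tau> \<in> Poly_Mapping.keys (cone_chain (p v) (prism p q \<sigma>) :: (_, 'k) chain)"
    using Cons.prems keys_diff by (fastforce split: if_splits)
  then show ?case
  proof
    assume "\<tau> \<in> Poly_Mapping.keys (cone_chain (p v) (prism p q \<sigma>) :: (_, 'k) chain)"
    then obtain \<rho> where "\<rho> \<in> Poly_Mapping.keys (prism p q \<sigma> :: (_, 'k) chain)" "\<tau> = p v # \<rho>"
      using keys_chain_extend unfolding cone_chain_def by fastforce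
    then show ?thesis using Cons.IH by fastforce
  qed auto
qed simp

text \<open>
  The augmentation is invisible here: a prism consists of lists with at least two entries, and the
  two boundaries differ on single vertices only, by the empty list, whose prism is \<open>0\<close>.
\<close>

lemma prism_homotopy_simplex:
  "chain_boundary (prism p q \<sigma>) + chain_extend (prism p q) (simplex_boundary \<sigma>)
     = Poly_Mapping.single (map q \<sigma>) 1 - Poly_Mapping.single (map p \<sigma>) (1 :: 'k::field)"
proof -
  have "chain_boundary (prism p q \<sigma> :: (_, 'k) chain) = chain_extend augmented_boundary (prism p q \<sigma>)"
    unfolding chain_boundary_def
    by (rule chain_extend_cong, rule simplex_boundary_eq_augmented) (auto dest: keys_prism simp: neq_Nil_conv)
  moreover have "chain_extend (prism p q) (simplex_boundary \<sigma>)
      = (chain_extend (prism p q) (augmented_boundary \<sigma>) :: (_, 'k) chain)"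
  proof (cases "length \<sigma> > 1")
    case True
    then show ?thesis by (simp only: simplex_boundary_eq_augmented)
  next
    case False
    then have "\<sigma> = [] \<or> (\<exists>v. \<sigma> = [v])" by (cases \<sigma>) auto
    then show ?thesis by (auto simp: simplex_boundary_def cone_chain_def)
  qed
  ultimately show ?thesis using prism_homotopy_augmented by metis
qed

lemma prism_homotopy:
  "chain_boundary (chain_extend (prism p q) c) + chain_extend (prism p q) (chain_boundary c)
     = push_chain q c - push_chain p c"
  unfolding chain_boundary_def chain_extend_compose push_chain_def
    chain_extend_add_fun[symmetric] chain_extend_diff_fun[symmetric]
  by (rule chain_extend_cong) (rule prism_homotopy_simplex[unfolded chain_boundary_def])

lemma chain_boundary_push: "chain_boundary (push_chain p c) = push_chain p (chain_boundary (c :: ('v, 'k::field) chain))"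
proof -
  have "simplex_boundary (map p \<sigma>) = (push_chain p (simplex_boundary \<sigma>) :: (_, 'k) chain)" for \<sigma>
    by (simp add: simplex_boundary_def push_chain_def chain_linear take_map drop_map)
  then show ?thesis
    by (simp add: chain_boundary_def push_chain_def chain_extend_compose)
qed


lemma push_chain_compose: "push_chain q (push_chain p c) = push_chain (q \<circ> p) c"
  by (simp add: push_chain_def chain_extend_compose)


section \<open>Functoriality of simplicial homology\<close>

lemma chains_zero [simp]: "0 \<in> chains K k"
  and chains_add: "c \<in> chains K k \<Longrightarrow> d \<in> chains K k \<Longrightarrow> c + d \<in> chains K k"
  and chains_scale: "c \<in> chains K k \<Longrightarrow> chain_scale a c \<in> chains K k"
  using keys_add[of c d] keys_chain_scale[of a c] by (auto simp: chains_def)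

lemma chain_boundary_zero [simp]: "chain_boundary 0 = 0"
  and chain_boundary_add: "chain_boundary (c + d) = chain_boundary c + chain_boundary d"
  and chain_boundary_scale: "chain_boundary (chain_scale a c) = chain_scale a (chain_boundary c)"
  by (simp_all add: chain_boundary_def chain_linear)

lemma cycles_zero [simp]: "0 \<in> cycles K k"
  and cycles_add: "c \<in> cycles K k \<Longrightarrow> d \<in> cycles K k \<Longrightarrow> c + d \<in> cycles K k"
  and cycles_scale: "c \<in> cycles K k \<Longrightarrow> chain_scale a c \<in> cycles K k"
  by (simp_all add: cycles_def chains_add chains_scale chain_boundary_add chain_boundary_scale)

lemma boundaries_zero [simp]: "0 \<in> boundaries K k"
  by (metis boundaries_def chain_boundary_zero chains_zero imageI)

lemma boundaries_add: "c \<in> boundaries K k \<Longrightarrow> d \<in> boundaries K k \<Longrightarrow> c + d \<in> boundaries K k"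
  by (auto simp: boundaries_def chain_boundary_add[symmetric] intro!: imageI chains_add)

lemma boundaries_scale: "c \<in> boundaries K k \<Longrightarrow> chain_scale a c \<in> boundaries K k"
  by (auto simp: boundaries_def chain_boundary_scale[symmetric] intro!: imageI chains_scale)

lemma boundaries_uminus: "c \<in> boundaries K k \<Longrightarrow> - c \<in> boundaries K k"
proof -
  have "chain_scale (- 1) c = - c" by (rule poly_mapping_eqI) simp
  then show "c \<in> boundaries K k \<Longrightarrow> - c \<in> boundaries K k" using boundaries_scale by metis
qed

lemma boundaries_plus_boundaries [simp]: "boundaries K k + boundaries K k = boundaries K k"
proof
  show "boundaries K k + boundaries K k \<subseteq> boundaries K k"
    by (auto elim!: set_plus_elim intro: boundaries_add)
  show "boundaries K k \<subseteq> boundaries K k + boundaries K k"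
    using set_plus_intro[OF _ boundaries_zero] by fastforce
qed

lemma homology_class_zero: "homology_class K k 0 = boundaries K k"
  by (simp add: homology_class_def elt_set_plus_def)

lemma mem_homology_class: "w \<in> homology_class K k z \<longleftrightarrow> (\<exists>b\<in>boundaries K k. w = z + b)"
  by (simp add: homology_class_def elt_set_plus_def)

lemma homology_class_absorb:
  fixes z b :: "('v, 'k::field) chain"
  assumes "b \<in> boundaries K k"
  shows "homology_class K k (z + b) = homology_class K k z"
proof -
  have "boundaries K k \<subseteq> b +o boundaries K k"
  proof
    fix c :: "('v, 'k) chain" assume "c \<in> boundaries K k"
    then have "c - b \<in> boundaries K k"
      using assms boundaries_add[OF _ boundaries_uminus] by fastforce
    then show "c \<in> b +o boundaries K k"
      using set_plus_intro2[of "c - b" "boundaries K k" b] by simp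
  qed
  moreover have "b +o boundaries K k \<subseteq> boundaries K k"
    using set_plus_mono3[OF assms] by (metis boundaries_plus_boundaries)
  ultimately have "b +o boundaries K k = boundaries K k" by blast
  then show ?thesis
    by (metis homology_class_def set_plus_rearrange2)
qed

lemma homology_class_add:
  "homology_class K k z + homology_class K k w = homology_class K k (z + w)"
  by (simp add: homology_class_def set_plus_rearrange)

lemma UN_eq_const: "a \<in> A \<Longrightarrow> (\<And>x. x \<in> A \<Longrightarrow> f x = c) \<Longrightarrow> (\<Union>x\<in>A. f x) = c"
  by auto

lemma homology_class_self: "z \<in> homology_class K k z"
  by (metis mem_homology_class boundaries_zero add.right_neutral)

lemma homology_class_smult:
  "a \<odot>\<^bsub>simplicial_homology K k\<^esub> homology_class K k z = homology_class K k (chain_scale a z)"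
proof -
  have "homology_class K k (chain_scale a w) = homology_class K k (chain_scale a z)"
    if "w \<in> homology_class K k z" for w
    using that by (auto simp: mem_homology_class chain_scale_add_right homology_class_absorb boundaries_scale)
  then have "(\<Union>w\<in>homology_class K k z. homology_class K k (chain_scale a w)) = homology_class K k (chain_scale a z)"
    by (rule UN_eq_const[OF homology_class_self])
  then show ?thesis
    by (simp add: simplicial_homology_def)
qed

definition simplicial_map :: "'v set set \<Rightarrow> 'w set set \<Rightarrow> ('v \<Rightarrow> 'w) \<Rightarrow> bool" where
  "simplicial_map K L p \<longleftrightarrow> (\<forall>s\<in>K. p ` s \<in> L)"

lemma push_chain_chains:
  assumes "simplicial_map K L p" "c \<in> chains K k"
  shows "push_chain p c \<in> chains L k"
proof -
  have "Poly_Mapping.keys (push_chain p c) \<subseteq> map p ` Poly_Mapping.keys c"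
    using keys_chain_extend[of "\<lambda>\<sigma>. Poly_Mapping.single (map p \<sigma>) 1" c]
    by (auto simp: push_chain_def)
  with assms show ?thesis by (auto simp: chains_def simplicial_map_def)
qed

lemma push_chain_cycles:
  fixes c :: "('v, 'k::field) chain"
  assumes "simplicial_map K L p" "c \<in> cycles K k"
  shows "push_chain p c \<in> cycles L k"
proof -
  have "push_chain p 0 = (0 :: (_, 'k) chain)" by (simp add: push_chain_def)
  with assms show ?thesis by (simp add: cycles_def push_chain_chains chain_boundary_push)
qed

lemma push_chain_boundaries:
  fixes b :: "('v, 'k::field) chain"
  assumes "simplicial_map K L p" "b \<in> boundaries K k"
  shows "push_chain p b \<in> boundaries L k"
  using assms by (auto simp: boundaries_def chain_boundary_push[symmetric] intro!: imageI push_chain_chains)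

lemma simplicial_induced_class:
  fixes z :: "('v, 'k::field) chain"
  assumes "simplicial_map K L p"
  shows "simplicial_induced L k p (homology_class K k z) = homology_class L k (push_chain p z)"
proof -
  have "homology_class L k (push_chain p w) = homology_class L k (push_chain p z)"
    if w: "w \<in> homology_class K k z" for w
  proof -
    obtain b where b: "b \<in> boundaries K k" "w = z + b" using w by (auto simp: mem_homology_class)
    have "push_chain p w = push_chain p z + push_chain p b"
      by (simp add: b push_chain_def chain_linear)
    then show ?thesis
      using homology_class_absorb[OF push_chain_boundaries[OF assms b(1)]] by simp
  qed
  then have "(\<Union>w\<in>homology_class K k z. homology_class L k (push_chain p w))
      = homology_class L k (push_chain p z)"
    by (rule UN_eq_const[OF homology_class_self])
  then show ?thesis
    by (simp add: simplicial_induced_def push_chain_def)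
qed

text \<open>
  On a cycle \<open>z\<close> the homotopy formula exhibits the difference of the two images as the boundary of
  the prism over \<open>z\<close>; contiguity is what places this prism in \<open>L\<close>.
\<close>

lemma contiguous_homology_class:
  fixes z :: "('v, 'k::field) chain"
  assumes contig: "\<And>s t. s \<in> K \<Longrightarrow> t \<subseteq> p ` s \<union> q ` s \<Longrightarrow> t \<noteq> {} \<Longrightarrow> t \<in> L"
    and z: "z \<in> cycles K k"
  shows "homology_class L k (push_chain p z) = homology_class L k (push_chain q z)"
proof -
  let ?h = "chain_extend (prism p q) z"
  have "?h \<in> chains L (k + 1)"
    unfolding chains_def
  proof (intro CollectI ballI)
    fix \<tau> assume "\<tau> \<in> Poly_Mapping.keys ?h"
    then obtain \<sigma> where \<sigma>: "\<sigma> \<in> Poly_Mapping.keys z" "\<tau> \<in> Poly_Mapping.keys (prism p q \<sigma> :: (_, 'k) chain)"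
      using keys_chain_extend by blast
    have "int (length \<sigma>) = k + 1" "set \<sigma> \<in> K"
      using z \<sigma>(1) by (auto simp: cycles_def chains_def)
    moreover have "length \<tau> = Suc (length \<sigma>)" "set \<tau> \<subseteq> p ` set \<sigma> \<union> q ` set \<sigma>"
      using keys_prism[OF \<sigma>(2)] by auto
    moreover from this have "set \<tau> \<noteq> {}" by auto
    ultimately show "int (length \<tau>) = k + 1 + 1 \<and> set \<tau> \<in> L"
      using contig by auto
  qed
  then have "chain_boundary ?h \<in> boundaries L k" by (simp add: boundaries_def)
  moreover have "push_chain q z = push_chain p z + chain_boundary ?h"
    using prism_homotopy[of p q z] z by (simp add: cycles_def algebra_simps)
  ultimately show ?thesis using homology_class_absorb by metis
qed


section \<open>Functoriality of Cech homology\<close>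

text \<open>
  The vertex maps that represent \<open>g\<close> on nerves. For the identity these are the refinement
  projections, and the vertex map from the preimage cover that defines the induced map is another
  example. Treating both alike makes every comparison of composites an instance of contiguity.
\<close>

definition cover_map :: "('x \<Rightarrow> 'y) \<Rightarrow> 'x set set \<Rightarrow> 'y set set \<Rightarrow> ('x set \<Rightarrow> 'y set) \<Rightarrow> bool" where
  "cover_map g \<V> \<U> q \<longleftrightarrow> (\<forall>V\<in>\<V>. q V \<in> \<U> \<and> g ` V \<subseteq> q V)"

lemma refinement_projection_iff_cover_map:
  "refinement_projection \<V> \<U> p \<longleftrightarrow> cover_map (\<lambda>x. x) \<V> \<U> p"
  by (simp add: refinement_projection_def cover_map_def)

lemma cover_map_compose:
  "cover_map g \<W> \<V> p \<Longrightarrow> cover_map g' \<V> \<U> q \<Longrightarrow> cover_map (\<lambda>x. g' (g x)) \<W> \<U> (q \<circ> p)"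
  by (fastforce simp: cover_map_def)

text \<open>
  If \<open>x\<close> lies in every member of \<open>s\<close>, then \<open>g x\<close> lies in the image of every member under either
  vertex map.
\<close>

lemma cover_maps_contiguous:
  assumes "cover_map g \<V> \<U> p" "cover_map g \<V> \<U> q" "s \<in> nerve \<V>"
    and "t \<subseteq> p ` s \<union> q ` s" "t \<noteq> {}"
  shows "t \<in> nerve \<U>"
proof -
  obtain x where x: "x \<in> \<Inter>s" using assms(3) by (auto simp: nerve_def)
  have s: "s \<subseteq> \<V>" "finite s" using assms(3) by (auto simp: nerve_def)
  have "g x \<in> \<Inter>t"
    using assms(1,2,4) x s(1) by (fastforce simp: cover_map_def)
  moreover have "finite t" using assms(4) s(2) finite_subset by blast
  moreover have "t \<subseteq> \<U>" using assms(1,2,4) s(1) by (fastforce simp: cover_map_def)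
  ultimately show ?thesis using assms(5) by (auto simp: nerve_def)
qed

lemma cover_map_simplicial:
  assumes "cover_map g \<V> \<U> p"
  shows "simplicial_map (nerve \<V>) (nerve \<U>) p"
  unfolding simplicial_map_def
proof
  fix s assume "s \<in> nerve \<V>"
  then show "p ` s \<in> nerve \<U>"
    using cover_maps_contiguous[OF assms assms, of s "p ` s"] by (auto simp: nerve_def)
qed

definition preimage :: "'x topology \<Rightarrow> ('x \<Rightarrow> 'y) \<Rightarrow> 'y set \<Rightarrow> 'x set" where
  "preimage X g U = {x \<in> topspace X. g x \<in> U}"

lemma preimage_open_cover:
  assumes "continuous_map X Y g" "\<U> \<in> open_covers Y"
  shows "preimage X g ` \<U> \<in> open_covers X"
proof -
  have "openin X (preimage X g U)" if "U \<in> \<U>" for U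
    using that assms openin_continuous_map_preimage unfolding preimage_def open_covers_def by blast
  moreover have "g x \<in> \<Union>\<U>" if "x \<in> topspace X" for x
    using that assms continuous_map_image_subset_topspace unfolding open_covers_def by fastforce
  ultimately show ?thesis
    by (auto simp: open_covers_def preimage_def)
qed

lemma cover_map_inv_preimage: "cover_map g (preimage X g ` \<U>) \<U> (inv_into \<U> (preimage X g))"
  unfolding cover_map_def
proof (intro ballI conjI)
  fix V assume V: "V \<in> preimage X g ` \<U>"
  then show "inv_into \<U> (preimage X g) V \<in> \<U>" by (rule inv_into_into)
  have "V = preimage X g (inv_into \<U> (preimage X g) V)" using V by (simp add: f_inv_into_f)
  then show "g ` V \<subseteq> inv_into \<U> (preimage X g) V" by (auto simp: preimage_def)
qed

lemma cech_induced_apply: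
  "\<U> \<in> open_covers Y \<Longrightarrow> cech_induced X Y k g h \<U> =
     simplicial_induced (nerve \<U>) k (inv_into \<U> (preimage X g)) (h (preimage X g ` \<U>))"
  by (simp add: cech_induced_def Let_def preimage_def[abs_def])

lemma cech_component:
  assumes "h \<in> carrier (cech_homology X k)" "\<U> \<in> open_covers X"
  obtains z where "z \<in> cycles (nerve \<U>) k" "h \<U> = homology_class (nerve \<U>) k z"
  using assms by (auto simp: cech_homology_def simplicial_homology_def dest!: PiE_mem)

lemma cech_compatible:
  assumes "h \<in> carrier (cech_homology X k)" "\<U> \<in> open_covers X" "\<V> \<in> open_covers X"
    and "refinement_projection \<V> \<U> p"
  shows "simplicial_induced (nerve \<U>) k p (h \<V>) = h \<U>"
  using assms by (simp add: cech_homology_def)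

lemma cech_carrierI:
  assumes "h \<in> extensional (open_covers X)"
    and "\<And>\<U>. \<U> \<in> open_covers X \<Longrightarrow> \<exists>z\<in>cycles (nerve \<U>) k. h \<U> = homology_class (nerve \<U>) k z"
    and "\<And>\<U> \<V> p. \<U> \<in> open_covers X \<Longrightarrow> \<V> \<in> open_covers X \<Longrightarrow> refinement_projection \<V> \<U> p \<Longrightarrow>
            simplicial_induced (nerve \<U>) k p (h \<V>) = h \<U>"
  shows "h \<in> carrier (cech_homology X k)"
  using assms by (fastforce simp: cech_homology_def simplicial_homology_def PiE_def)

lemma simplicial_induced_compose:
  assumes "simplicial_map K L p" "simplicial_map L M q"
  shows "simplicial_induced M k q (simplicial_induced L k p (homology_class K k z))
     = simplicial_induced M k (q \<circ> p) (homology_class K k z)"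
proof -
  have "simplicial_map K M (q \<circ> p)"
    using assms unfolding simplicial_map_def image_comp[symmetric] by blast
  then show ?thesis
    by (simp add: simplicial_induced_class[OF assms(1)] simplicial_induced_class[OF assms(2)]
        simplicial_induced_class push_chain_compose)
qed

text \<open>
  The map \<open>q\<close> followed by taking preimages is a refinement projection onto the preimage cover, so
  compatibility of \<open>h\<close> expresses the component that defines the induced map by \<open>h \<V>\<close>. Returning
  to \<open>\<U>\<close> by the chosen inverse of the preimage need not give \<open>q\<close> back, but gives a map
  contiguous to it.
\<close>

lemma cech_induced_cover_map:
  assumes g: "continuous_map X Y g" and h: "h \<in> carrier (cech_homology X k)"
    and \<V>: "\<V> \<in> open_covers X" and \<U>: "\<U> \<in> open_covers Y" and q: "cover_map g \<V> \<U> q"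
  shows "cech_induced X Y k g h \<U> = simplicial_induced (nerve \<U>) k q (h \<V>)"
proof -
  let ?pre = "preimage X g"
  let ?i = "inv_into \<U> ?pre" and ?p = "?pre \<circ> q"
  obtain z where z: "z \<in> cycles (nerve \<V>) k" "h \<V> = homology_class (nerve \<V>) k z"
    using cech_component[OF h \<V>] .
  have "V \<subseteq> topspace X" if "V \<in> \<V>" for V using that \<V> by (auto simp: open_covers_def)
  then have p: "cover_map (\<lambda>x. x) \<V> (?pre ` \<U>) ?p"
    using q by (fastforce simp: cover_map_def preimage_def)
  have i: "cover_map g (?pre ` \<U>) \<U> ?i" by (rule cover_map_inv_preimage)
  have ip: "cover_map g \<V> \<U> (?i \<circ> ?p)" using cover_map_compose[OF p i] .
  have "h (?pre ` \<U>) = simplicial_induced (nerve (?pre ` \<U>)) k ?p (h \<V>)"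
    using cech_compatible[OF h preimage_open_cover[OF g \<U>] \<V>] p
    by (simp add: refinement_projection_iff_cover_map)
  then have "cech_induced X Y k g h \<U> = simplicial_induced (nerve \<U>) k (?i \<circ> ?p) (h \<V>)"
    unfolding cech_induced_apply[OF \<U>]
    by (simp only: z(2) simplicial_induced_compose[OF cover_map_simplicial[OF p] cover_map_simplicial[OF i]])
  also have "\<dots> = simplicial_induced (nerve \<U>) k q (h \<V>)"
    unfolding z(2) simplicial_induced_class[OF cover_map_simplicial[OF ip]]
      simplicial_induced_class[OF cover_map_simplicial[OF q]]
    using cover_maps_contiguous[OF ip q] by (rule contiguous_homology_class[OF _ z(1)])
  finally show ?thesis .
qed

lemma cech_induced_closed:
  assumes g: "continuous_map X Y g" and h: "h \<in> carrier (cech_homology X k)"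
  shows "cech_induced X Y k g h \<in> carrier (cech_homology Y k)"
proof (rule cech_carrierI)
  show "cech_induced X Y k g h \<in> extensional (open_covers Y)"
    by (simp add: cech_induced_def Let_def)
next
  fix \<U> assume \<U>: "\<U> \<in> open_covers Y"
  let ?pre = "preimage X g"
  note i = cover_map_simplicial[OF cover_map_inv_preimage[of g X \<U>]]
  obtain z where z: "z \<in> cycles (nerve (?pre ` \<U>)) k" "h (?pre ` \<U>) = homology_class (nerve (?pre ` \<U>)) k z"
    using cech_component[OF h preimage_open_cover[OF g \<U>]] .
  then show "\<exists>z\<in>cycles (nerve \<U>) k. cech_induced X Y k g h \<U> = homology_class (nerve \<U>) k z"
    using push_chain_cycles[OF i z(1)] by (auto simp: cech_induced_apply[OF \<U>] simplicial_induced_class[OF i])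
next
  fix \<U> \<V> p assume \<U>: "\<U> \<in> open_covers Y" and \<V>: "\<V> \<in> open_covers Y" and "refinement_projection \<V> \<U> p"
  then have p: "cover_map (\<lambda>x. x) \<V> \<U> p" by (simp add: refinement_projection_iff_cover_map)
  let ?pre = "preimage X g"
  note i = cover_map_inv_preimage[of g X \<V>]
  note pre\<V> = preimage_open_cover[OF g \<V>]
  obtain z where z: "h (?pre ` \<V>) = homology_class (nerve (?pre ` \<V>)) k z"
    using cech_component[OF h pre\<V>] by metis
  have "simplicial_induced (nerve \<U>) k p (cech_induced X Y k g h \<V>)
      = simplicial_induced (nerve \<U>) k (p \<circ> inv_into \<V> ?pre) (h (?pre ` \<V>))"
    by (simp only: cech_induced_apply[OF \<V>] z
        simplicial_induced_compose[OF cover_map_simplicial[OF i] cover_map_simplicial[OF p]])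
  also have "\<dots> = cech_induced X Y k g h \<U>"
    using cech_induced_cover_map[OF g h pre\<V> \<U>] cover_map_compose[OF i p] by simp
  finally show "simplicial_induced (nerve \<U>) k p (cech_induced X Y k g h \<V>) = cech_induced X Y k g h \<U>" .
qed

lemma cech_induced_compose:
  assumes g: "continuous_map X Y g" and g': "continuous_map Y Z g'"
    and h: "h \<in> carrier (cech_homology X k)"
  shows "cech_induced Y Z k g' (cech_induced X Y k g h) = cech_induced X Z k (\<lambda>x. g' (g x)) h"
proof
  fix \<U> :: "'c set set"
  show "cech_induced Y Z k g' (cech_induced X Y k g h) \<U> = cech_induced X Z k (\<lambda>x. g' (g x)) h \<U>"
  proof (cases "\<U> \<in> open_covers Z")
    case True
    let ?\<V> = "preimage Y g' ` \<U>" let ?\<W> = "preimage X g ` ?\<V>"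
    have \<V>: "?\<V> \<in> open_covers Y" using preimage_open_cover[OF g' True] .
    have \<W>: "?\<W> \<in> open_covers X" using preimage_open_cover[OF g \<V>] .
    note i = cover_map_inv_preimage[of g X ?\<V>] and i' = cover_map_inv_preimage[of g' Y \<U>]
    obtain z where z: "h ?\<W> = homology_class (nerve ?\<W>) k z"
      using cech_component[OF h \<W>] by metis
    have "continuous_map X Z (\<lambda>x. g' (g x))"
      using continuous_map_compose[OF g g'] by (simp add: comp_def)
    from cech_induced_cover_map[OF this h \<W> True cover_map_compose[OF i i']]
    show ?thesis
      by (simp only: cech_induced_apply[OF True] cech_induced_apply[OF \<V>] z
          simplicial_induced_compose[OF cover_map_simplicial[OF i] cover_map_simplicial[OF i']])
  qed (simp add: cech_induced_def Let_def)
qed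


section \<open>The vector space structure of Cech homology\<close>

lemma simplicial_homology_simps [simp]:
  "\<zero>\<^bsub>simplicial_homology K k\<^esub> = boundaries K k"
  "A \<oplus>\<^bsub>simplicial_homology K k\<^esub> B = A + B"
  by (simp_all add: simplicial_homology_def)

lemma cech_homology_simps [simp]:
  "\<zero>\<^bsub>cech_homology X k\<^esub> = (\<lambda>\<U>\<in>open_covers X. boundaries (nerve \<U>) k)"
  "h \<oplus>\<^bsub>cech_homology X k\<^esub> h' = (\<lambda>\<U>\<in>open_covers X. h \<U> + h' \<U>)"
  "a \<odot>\<^bsub>cech_homology X k\<^esub> h = (\<lambda>\<U>\<in>open_covers X. a \<odot>\<^bsub>simplicial_homology (nerve \<U>) k\<^esub> h \<U>)"
  by (simp_all add: cech_homology_def)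

lemma push_chain_linear:
  "push_chain p 0 = 0"
  "push_chain p (c + d) = push_chain p c + push_chain p d"
  "push_chain p (chain_scale a c) = chain_scale a (push_chain p c)"
  by (simp_all add: push_chain_def chain_linear)

lemma cech_zero_closed: "\<zero>\<^bsub>cech_homology X k\<^esub> \<in> carrier (cech_homology X k)"
proof (rule cech_carrierI)
  fix \<U> \<V> p assume "\<U> \<in> open_covers X" "\<V> \<in> open_covers X" "refinement_projection \<V> \<U> p"
  then show "simplicial_induced (nerve \<U>) k p (\<zero>\<^bsub>cech_homology X k\<^esub> \<V>) = \<zero>\<^bsub>cech_homology X k\<^esub> \<U>"
    using simplicial_induced_class[OF cover_map_simplicial, of _ \<V> \<U> p k 0]
    by (simp add: refinement_projection_iff_cover_map homology_class_zero push_chain_linear)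
qed (auto simp: homology_class_zero[symmetric] intro: cycles_zero)

lemma cech_add_closed:
  assumes h: "h \<in> carrier (cech_homology X k)" and h': "h' \<in> carrier (cech_homology X k)"
  shows "h \<oplus>\<^bsub>cech_homology X k\<^esub> h' \<in> carrier (cech_homology X k)"
proof (rule cech_carrierI)
  fix \<U> assume \<U>: "\<U> \<in> open_covers X"
  show "\<exists>z\<in>cycles (nerve \<U>) k. (h \<oplus>\<^bsub>cech_homology X k\<^esub> h') \<U> = homology_class (nerve \<U>) k z"
    by (rule cech_component[OF h \<U>], rule cech_component[OF h' \<U>])
       (auto simp: \<U> homology_class_add intro: cycles_add)
next
  fix \<U> \<V> p assume \<U>: "\<U> \<in> open_covers X" and \<V>: "\<V> \<in> open_covers X" and p: "refinement_projection \<V> \<U> p"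
  then have ind: "simplicial_induced (nerve \<U>) k p (homology_class (nerve \<V>) k z)
      = homology_class (nerve \<U>) k (push_chain p z)" for z
    using simplicial_induced_class cover_map_simplicial refinement_projection_iff_cover_map by metis
  obtain z where z: "h \<V> = homology_class (nerve \<V>) k z" using cech_component[OF h \<V>] by metis
  obtain z' where z': "h' \<V> = homology_class (nerve \<V>) k z'" using cech_component[OF h' \<V>] by metis
  have "h \<U> = homology_class (nerve \<U>) k (push_chain p z)"
    "h' \<U> = homology_class (nerve \<U>) k (push_chain p z')"
    using cech_compatible[OF h \<U> \<V> p] cech_compatible[OF h' \<U> \<V> p] by (simp_all add: z z' ind)
  then show "simplicial_induced (nerve \<U>) k p ((h \<oplus>\<^bsub>cech_homology X k\<^esub> h') \<V>) = (h \<oplus>\<^bsub>cech_homology X k\<^esub> h') \<U>"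
    by (simp add: \<U> \<V> z z' ind homology_class_add push_chain_linear)
qed simp

lemma cech_smult_closed:
  assumes h: "h \<in> carrier (cech_homology X k)"
  shows "a \<odot>\<^bsub>cech_homology X k\<^esub> h \<in> carrier (cech_homology X k)"
proof (rule cech_carrierI)
  fix \<U> assume \<U>: "\<U> \<in> open_covers X"
  show "\<exists>z\<in>cycles (nerve \<U>) k. (a \<odot>\<^bsub>cech_homology X k\<^esub> h) \<U> = homology_class (nerve \<U>) k z"
    by (rule cech_component[OF h \<U>]) (auto simp: \<U> homology_class_smult intro: cycles_scale)
next
  fix \<U> \<V> p assume \<U>: "\<U> \<in> open_covers X" and \<V>: "\<V> \<in> open_covers X" and p: "refinement_projection \<V> \<U> p"
  then have ind: "simplicial_induced (nerve \<U>) k p (homology_class (nerve \<V>) k z)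
      = homology_class (nerve \<U>) k (push_chain p z)" for z
    using simplicial_induced_class cover_map_simplicial refinement_projection_iff_cover_map by metis
  obtain z where z: "h \<V> = homology_class (nerve \<V>) k z" using cech_component[OF h \<V>] by metis
  have "h \<U> = homology_class (nerve \<U>) k (push_chain p z)"
    using cech_compatible[OF h \<U> \<V> p] by (simp add: z ind)
  then show "simplicial_induced (nerve \<U>) k p ((a \<odot>\<^bsub>cech_homology X k\<^esub> h) \<V>) = (a \<odot>\<^bsub>cech_homology X k\<^esub> h) \<U>"
    by (simp add: \<U> \<V> z ind homology_class_smult push_chain_linear)
qed simp

lemma abelian_monoid_cech_homology: "abelian_monoid (cech_homology X k)"
proof (rule abelian_monoidI)
  fix h assume h: "h \<in> carrier (cech_homology X k)"
  show "\<zero>\<^bsub>cech_homology X k\<^esub> \<oplus>\<^bsub>cech_homology X k\<^esub> h = h"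
  proof (rule extensionalityI)
    show "h \<in> extensional (open_covers X)" using h by (simp add: cech_homology_def PiE_def)
    fix \<U> assume \<U>: "\<U> \<in> open_covers X"
    obtain z where "h \<U> = homology_class (nerve \<U>) k z" using cech_component[OF h \<U>] by metis
    then show "(\<zero>\<^bsub>cech_homology X k\<^esub> \<oplus>\<^bsub>cech_homology X k\<^esub> h) \<U> = h \<U>"
      using \<U> homology_class_add[of "nerve \<U>" k 0 z] by (simp add: homology_class_zero)
  qed simp
qed (auto simp: cech_zero_closed[simplified] cech_add_closed[simplified] ac_simps cong: restrict_cong)

section \<open>Invariance of dimension under isomorphism\<close>

lemma lin_independent_image:
  assumes M: "abelian_monoid M" and N: "abelian_monoid N"
    and smult: "\<And>a x. x \<in> carrier M \<Longrightarrow> a \<odot>\<^bsub>M\<^esub> x \<in> carrier M"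
    and T: "linear_iso M N T" and S: "S \<subseteq> carrier M"
  shows "lin_independent N (T ` S) \<longleftrightarrow> lin_independent M S"
proof -
  interpret M: abelian_monoid M by fact
  interpret N: abelian_monoid N by fact
  have bij: "bij_betw T (carrier M) (carrier N)"
    and add: "\<And>x y. x \<in> carrier M \<Longrightarrow> y \<in> carrier M \<Longrightarrow> T (x \<oplus>\<^bsub>M\<^esub> y) = T x \<oplus>\<^bsub>N\<^esub> T y"
    and smultT: "\<And>a x. x \<in> carrier M \<Longrightarrow> T (a \<odot>\<^bsub>M\<^esub> x) = a \<odot>\<^bsub>N\<^esub> T x"
    using T by (auto simp: linear_iso_def)
  have inj: "inj_on T (carrier M)" and TM: "\<And>x. x \<in> carrier M \<Longrightarrow> T x \<in> carrier N"
    using bij by (auto simp: bij_betw_def)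
  have injS: "inj_on T S" using inj S inj_on_subset by blast
  \<comment> \<open>Only monoids are at hand, so \<open>T \<zero> = \<zero>\<close> is deduced from surjectivity: \<open>\<zero>\<close> is the image of
    some \<open>x0\<close>, and \<open>T \<zero>\<close> is neutral for \<open>T x0\<close>.\<close>
  obtain x0 where x0: "x0 \<in> carrier M" "T x0 = \<zero>\<^bsub>N\<^esub>"
    using bij N.zero_closed by (metis bij_betw_def imageE)
  have T0: "T \<zero>\<^bsub>M\<^esub> = \<zero>\<^bsub>N\<^esub>"
    using add[OF x0(1) M.zero_closed] x0 TM[OF M.zero_closed] by simp
  have sum: "T (\<Oplus>\<^bsub>M\<^esub>x\<in>S'. c (T x) \<odot>\<^bsub>M\<^esub> x) = (\<Oplus>\<^bsub>N\<^esub>y\<in>T ` S'. c y \<odot>\<^bsub>N\<^esub> y)"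
    if "finite S'" "S' \<subseteq> S" for c S'
    using that
  proof (induction S')
    case empty
    then show ?case by (simp add: T0)
  next
    case (insert x F)
    have x: "x \<in> carrier M" and F: "F \<subseteq> carrier M" using insert S by auto
    have cM: "(\<lambda>x. c (T x) \<odot>\<^bsub>M\<^esub> x) \<in> F \<rightarrow> carrier M" using F smult by auto
    have smultN: "a \<odot>\<^bsub>N\<^esub> T w \<in> carrier N" if "w \<in> carrier M" for a w
      using that smult TM smultT by metis
    have cN: "(\<lambda>y. c y \<odot>\<^bsub>N\<^esub> y) \<in> T ` F \<rightarrow> carrier N" using F smultN by auto
    have "T x \<notin> T ` F" using insert injS by (auto dest: inj_onD)
    then show ?case
      using insert x cM cN
      by (simp add: M.finsum_insert N.finsum_insert smult smultN smultT add M.finsum_closed)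
  qed
  have kernel: "T x = \<zero>\<^bsub>N\<^esub> \<longleftrightarrow> x = \<zero>\<^bsub>M\<^esub>" if "x \<in> carrier M" for x
    using that inj T0 M.zero_closed by (metis inj_onD)
  have closed: "(\<Oplus>\<^bsub>M\<^esub>x\<in>S. c x \<odot>\<^bsub>M\<^esub> x) \<in> carrier M" for c
    using S smult by (intro M.finsum_closed) auto
  show ?thesis
  proof
    assume N: "lin_independent N (T ` S)"
    then have fin: "finite S" using injS by (simp add: lin_independent_def finite_image_iff)
    show "lin_independent M S"
      unfolding lin_independent_def
    proof (intro conjI allI impI)
      fix c assume c: "(\<Oplus>\<^bsub>M\<^esub>x\<in>S. c x \<odot>\<^bsub>M\<^esub> x) = \<zero>\<^bsub>M\<^esub>"
      let ?c = "\<lambda>y. c (inv_into S T y)"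
      have "(\<Oplus>\<^bsub>M\<^esub>x\<in>S. ?c (T x) \<odot>\<^bsub>M\<^esub> x) = (\<Oplus>\<^bsub>M\<^esub>x\<in>S. c x \<odot>\<^bsub>M\<^esub> x)"
        using S smult injS by (intro M.finsum_cong') auto
      then have "(\<Oplus>\<^bsub>N\<^esub>y\<in>T ` S. ?c y \<odot>\<^bsub>N\<^esub> y) = \<zero>\<^bsub>N\<^esub>"
        using sum[OF fin order_refl, of ?c] c T0 by simp
      then show "\<forall>x\<in>S. c x = 0" using N injS by (auto simp: lin_independent_def)
    qed (use S fin in auto)
  next
    assume M: "lin_independent M S"
    then have fin: "finite S" by (simp add: lin_independent_def)
    show "lin_independent N (T ` S)"
      unfolding lin_independent_def
    proof (intro conjI allI impI)
      fix c assume "(\<Oplus>\<^bsub>N\<^esub>y\<in>T ` S. c y \<odot>\<^bsub>N\<^esub> y) = \<zero>\<^bsub>N\<^esub>"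
      then have "(\<Oplus>\<^bsub>M\<^esub>x\<in>S. c (T x) \<odot>\<^bsub>M\<^esub> x) = \<zero>\<^bsub>M\<^esub>"
        using sum[OF fin order_refl, of c] kernel[OF closed, of "\<lambda>x. c (T x)"] by simp
      then show "\<forall>y\<in>T ` S. c y = 0"
        using M unfolding lin_independent_def by (auto dest: spec[of _ "\<lambda>x. c (T x)"])
    qed (use S TM fin in auto)
  qed
qed

text \<open>
  An isomorphism matches the independent subsets of \<open>A\<close> with those of its image, so the two suprema
  are over the same set of cardinalities.
\<close>

lemma subspace_dim_image:
  assumes "abelian_monoid M" "abelian_monoid N"
    and "\<And>a x. x \<in> carrier M \<Longrightarrow> a \<odot>\<^bsub>M\<^esub> x \<in> carrier M"
    and T: "linear_iso M N T" and A: "A \<subseteq> carrier M"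
  shows "subspace_dim N (T ` A) = subspace_dim M A"
proof -
  have inj: "inj_on T (carrier M)" using T by (auto simp: linear_iso_def bij_betw_def)
  have iff: "lin_independent N (T ` S) \<longleftrightarrow> lin_independent M S" if "S \<subseteq> A" for S
    using lin_independent_image[OF assms(1-4)] that A by blast
  have card: "card (T ` S) = card S" if "S \<subseteq> A" for S
    using that A inj by (meson card_image inj_on_subset order_trans)
  have "{card S |S. S \<subseteq> T ` A \<and> lin_independent N S} = {card S |S. S \<subseteq> A \<and> lin_independent M S}"
    (is "?L = ?R")
  proof
    show "?L \<subseteq> ?R" using iff card by (fastforce simp: subset_image_iff)
    show "?R \<subseteq> ?L"
    proof
      fix n assume "n \<in> ?R"
      then obtain S where "S \<subseteq> A" "lin_independent M S" "n = card S" by blast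
      then have "T ` S \<subseteq> T ` A \<and> lin_independent N (T ` S) \<and> n = card (T ` S)"
        using iff card by (simp add: image_mono)
      then show "n \<in> ?L" by blast
    qed
  qed
  then show ?thesis by (simp add: subspace_dim_def)
qed


section \<open>Persistent Betti numbers across an isomorphism\<close>

lemma continuous_map_sublevel:
  assumes "u \<le> v"
  shows "continuous_map (sublevel X f u) (sublevel X f v) (\<lambda>x. x)"
proof -
  have "topspace (sublevel X f u) \<subseteq> {x \<in> topspace X. f x \<le> v}"
    using assms by (auto simp: sublevel_def intro: order_trans)
  moreover have "continuous_map (sublevel X f u) X (\<lambda>x. x)"
    unfolding sublevel_def by (intro continuous_map_from_subtopology) simp
  ultimately show ?thesis
    unfolding sublevel_def[of X f v] continuous_map_in_subtopology by auto
qed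

lemma inclusion_map_closed:
  assumes "u \<le> v" "h \<in> carrier (sublevel_homology TYPE('k::field) k X f u)"
  shows "inclusion_map TYPE('k) k X f u v h \<in> carrier (sublevel_homology TYPE('k) k X f v)"
  using cech_induced_closed[OF continuous_map_sublevel[OF assms(1)]] assms(2)
  by (simp add: sublevel_homology_def inclusion_map_def)

lemma inclusion_map_compose:
  assumes "u \<le> v" "v \<le> w" "h \<in> carrier (sublevel_homology TYPE('k::field) k X f u)"
  shows "inclusion_map TYPE('k) k X f v w (inclusion_map TYPE('k) k X f u v h)
     = inclusion_map TYPE('k) k X f u w h"
  using cech_induced_compose[OF continuous_map_sublevel[OF assms(1)] continuous_map_sublevel[OF assms(2)]] assms(3)
  by (simp add: sublevel_homology_def inclusion_map_def)

lemma inclusion_image_compose: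
  assumes "u \<le> v" "v \<le> w"
  shows "inclusion_map TYPE('k) k X f v w ` inclusion_map TYPE('k) k X f u v `
        carrier (sublevel_homology TYPE('k::field) k X f u)
     = inclusion_map TYPE('k) k X f u w ` carrier (sublevel_homology TYPE('k) k X f u)"
  unfolding image_image by (rule image_cong) (simp_all add: inclusion_map_compose[OF assms])

definition sublevel_iso ::
    "'k::field itself \<Rightarrow> int \<Rightarrow> 'x topology \<Rightarrow> ('x \<Rightarrow> real ^ 'n) \<Rightarrow> real ^ 'n \<Rightarrow> real ^ 'n \<Rightarrow> bool" where
  "sublevel_iso K k X f u v \<longleftrightarrow>
     linear_iso (sublevel_homology K k X f u) (sublevel_homology K k X f v) (inclusion_map K k X f u v)"

lemma persistent_betti_iso_left:
  assumes "u \<le> v" "v \<le> w" "sublevel_iso TYPE('k::field) k X f u v"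
  shows "persistent_betti TYPE('k) k X f u w = persistent_betti TYPE('k) k X f v w"
proof -
  have "inclusion_map TYPE('k) k X f u v ` carrier (sublevel_homology TYPE('k) k X f u)
      = carrier (sublevel_homology TYPE('k) k X f v)"
    using assms(3) by (simp add: sublevel_iso_def linear_iso_def bij_betw_def)
  then show ?thesis
    using inclusion_image_compose[OF assms(1,2), where ?'k='k, of k X f]
    by (simp add: persistent_betti_def linear_rank_def)
qed

lemma persistent_betti_iso_right:
  assumes "u \<le> v" "v \<le> w" "sublevel_iso TYPE('k::field) k X f v w"
  shows "persistent_betti TYPE('k) k X f u w = persistent_betti TYPE('k) k X f u v"
proof -
  let ?H = "sublevel_homology TYPE('k) k X f" and ?i = "inclusion_map TYPE('k) k X f"
  have "subspace_dim (?H w) (?i v w ` ?i u v ` carrier (?H u)) = subspace_dim (?H v) (?i u v ` carrier (?H u))"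
  proof (rule subspace_dim_image)
    show "linear_iso (?H v) (?H w) (?i v w)" using assms(3) by (simp add: sublevel_iso_def)
    show "?i u v ` carrier (?H u) \<subseteq> carrier (?H v)" using inclusion_map_closed[OF assms(1)] by blast
  qed (simp_all only: sublevel_homology_def abelian_monoid_cech_homology cech_smult_closed)
  then show ?thesis
    by (simp add: persistent_betti_def linear_rank_def inclusion_image_compose[OF assms(1,2)])
qed

section \<open>Cornerpoints and critical values\<close>

lemma not_critical_value_iso:
  fixes u :: "real ^ 'n"
  assumes "\<not> homological_critical_value TYPE('k::field) X f u"
  obtains \<epsilon> where "\<epsilon> > 0"
    "\<And>\<delta>. 0 < \<delta> \<Longrightarrow> \<delta> < \<epsilon> \<Longrightarrow> sublevel_iso TYPE('k) k X f (u - (\<chi> i. \<delta>)) (u + (\<chi> i. \<delta>))"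
proof -
  have "\<exists>\<^sub>F \<epsilon> in at_right (0::real). \<not> (\<exists>u' u''. u' \<le> u \<and> u \<le> u'' \<and> infnorm (u' - u) < \<epsilon> \<and>
          infnorm (u'' - u) < \<epsilon> \<and> \<not> sublevel_iso TYPE('k) k X f u' u'')"
    using assms unfolding homological_critical_value_def sublevel_iso_def not_eventually[symmetric] by blast
  from frequently_eventually_conj[OF this eventually_at_right_less[of 0]]
  obtain \<epsilon> :: real where \<epsilon>: "\<epsilon> > 0" "\<And>u' u''. u' \<le> u \<Longrightarrow> u \<le> u'' \<Longrightarrow> infnorm (u' - u) < \<epsilon> \<Longrightarrow>
          infnorm (u'' - u) < \<epsilon> \<Longrightarrow> sublevel_iso TYPE('k) k X f u' u''"
    using frequently_ex by (smt (verit))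
  have norm: "infnorm (\<chi> i::'n. \<delta>) = \<delta>" if "0 < \<delta>" for \<delta> :: real
    using that by (simp add: infnorm_cart)
  show thesis
  proof (rule that[OF \<epsilon>(1)])
    fix \<delta> :: real assume "0 < \<delta>" "\<delta> < \<epsilon>"
    then show "sublevel_iso TYPE('k) k X f (u - (\<chi> i. \<delta>)) (u + (\<chi> i. \<delta>))"
      using norm[of \<delta>] infnorm_neg[of "\<chi> i::'n. \<delta>"] by (intro \<epsilon>(2)) (simp_all add: less_eq_vec_def)
  qed
qed

lemma multiplicity_proper_eq_0:
  fixes u v e :: "real ^ 'n"
  assumes "0 \<prec> e" "u + e \<prec> v - e"
    and "sublevel_iso TYPE('k::field) k X f (u - e) (u + e) \<or> sublevel_iso TYPE('k) k X f (v - e) (v + e)"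
  shows "multiplicity_proper TYPE('k) k X f u v = 0"
proof -
  let ?\<beta> = "\<lambda>s t. int (persistent_betti TYPE('k) k X f s t)"
  have le: "u - e \<le> u + e" "u + e \<le> v - e" "v - e \<le> v + e"
    using assms(1,2) by (fastforce simp: vec_less_def less_eq_vec_def less_imp_le)+
  have "0 = ?\<beta> (u + e) (v - e) - ?\<beta> (u - e) (v - e) - ?\<beta> (u + e) (v + e) + ?\<beta> (u - e) (v + e)"
    using assms(3)
  proof
    assume iso: "sublevel_iso TYPE('k) k X f (u - e) (u + e)"
    show ?thesis
      using persistent_betti_iso_left[OF le(1,2) iso] persistent_betti_iso_left[OF le(1) order_trans[OF le(2,3)] iso]
      by simp
  next
    assume iso: "sublevel_iso TYPE('k) k X f (v - e) (v + e)"
    show ?thesis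
      using persistent_betti_iso_right[OF le(2,3) iso] persistent_betti_iso_right[OF order_trans[OF le(1,2)] le(3) iso]
      by simp
  qed
  then show ?thesis
    unfolding multiplicity_proper_def Let_def using assms(1,2) by (intro Least_eq_0) auto
qed

lemma multiplicity_infinity_eq_0:
  fixes u e :: "real ^ 'n"
  assumes "0 \<prec> e" "sublevel_iso TYPE('k::field) k X f (u - e) (u + e)"
  shows "multiplicity_infinity TYPE('k) k X f u = 0"
proof -
  let ?\<beta> = "\<lambda>s t. int (persistent_betti TYPE('k) k X f s t)" and ?v = "u + e + e"
  have le: "u - e \<le> u + e" "u + e \<le> ?v" and less: "u + e \<prec> ?v"
    using assms(1) by (fastforce simp: vec_less_def less_eq_vec_def less_imp_le)+
  have "0 = ?\<beta> (u + e) ?v - ?\<beta> (u - e) ?v"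
    using persistent_betti_iso_left[OF le assms(2)] by simp
  then show ?thesis
    unfolding multiplicity_infinity_def Let_def using assms(1) less by (intro Least_eq_0) auto
qed

lemma small_constant_vector:
  fixes u v :: "real ^ 'n"
  assumes "u \<prec> v" "\<epsilon> > 0"
  obtains \<delta> :: real where "0 < \<delta>" "\<delta> < \<epsilon>" "u + (\<chi> i. \<delta>) \<prec> v - (\<chi> i. \<delta>)"
proof -
  define m where "m = Min (insert \<epsilon> (range (\<lambda>i. v $ i - u $ i)))"
  have m: "m > 0" using assms by (auto simp: m_def vec_less_def)
  have le: "m \<le> \<epsilon>" "\<And>i. m \<le> v $ i - u $ i" unfolding m_def by (rule Min_le; simp)+
  have "u $ i + m / 3 < v $ i - m / 3" for i
    using m le(2)[of i] by linarith
  then show thesis using m le(1) by (intro that[of "m / 3"]) (auto simp: vec_less_def)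
qed

theorem theorem5p3:
  fixes X :: "'x topology" and C :: "'e::euclidean_space set set"
    and f :: "'x \<Rightarrow> real ^ 'n" and k :: int
  assumes "compact_space X"
    and "simplicial_complex C" and "X homeomorphic_space top_of_set (\<Union>C)"
    and "continuous_map X euclidean f"
  shows "(\<forall>u v. proper_cornerpoint TYPE('k::field) k X f u v \<longrightarrow>
            homological_critical_value TYPE('k) X f u \<and> homological_critical_value TYPE('k) X f v) \<and>
         (\<forall>u. cornerpoint_at_infinity TYPE('k) k X f u \<longrightarrow> homological_critical_value TYPE('k) X f u)"
proof (intro conjI allI impI)
  fix u v :: "real ^ 'n"
  assume corner: "proper_cornerpoint TYPE('k) k X f u v"
  then have uv: "u \<prec> v" by (simp add: proper_cornerpoint_def)
  have no_iso: False
    if \<epsilon>: "\<epsilon> > 0" and iso: "\<And>\<delta>. 0 < \<delta> \<Longrightarrow> \<delta> < \<epsilon> \<Longrightarrow>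
        sublevel_iso TYPE('k) k X f (u - (\<chi> i. \<delta>)) (u + (\<chi> i. \<delta>)) \<or>
        sublevel_iso TYPE('k) k X f (v - (\<chi> i. \<delta>)) (v + (\<chi> i. \<delta>))" for \<epsilon> :: real
  proof -
    obtain \<delta> where \<delta>: "0 < \<delta>" "\<delta> < \<epsilon>" "u + (\<chi> i. \<delta>) \<prec> v - (\<chi> i. \<delta>)"
      using small_constant_vector[OF uv \<epsilon>] .
    have "0 \<prec> (\<chi> i::'n. \<delta>)" using \<delta>(1) by (simp add: vec_less_def)
    from multiplicity_proper_eq_0[OF this \<delta>(3) iso[OF \<delta>(1,2)]] show False
      using corner by (simp add: proper_cornerpoint_def)
  qed
  show "homological_critical_value TYPE('k) X f u"
    by (rule ccontr, erule not_critical_value_iso[where k = k], rule no_iso) blast+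
  show "homological_critical_value TYPE('k) X f v"
    by (rule ccontr, erule not_critical_value_iso[where k = k], rule no_iso) blast+
next
  fix u :: "real ^ 'n"
  assume corner: "cornerpoint_at_infinity TYPE('k) k X f u"
  show "homological_critical_value TYPE('k) X f u"
  proof (rule ccontr)
    assume "\<not> homological_critical_value TYPE('k) X f u"
    from not_critical_value_iso[OF this, where k = k] obtain \<epsilon> :: real where "\<epsilon> > 0"
      and iso: "\<And>\<delta>. 0 < \<delta> \<Longrightarrow> \<delta> < \<epsilon> \<Longrightarrow>
        sublevel_iso TYPE('k) k X f (u - (\<chi> i. \<delta>)) (u + (\<chi> i. \<delta>))" by blast
    then have "sublevel_iso TYPE('k) k X f (u - (\<chi> i. \<epsilon> / 2)) (u + (\<chi> i. \<epsilon> / 2))" by simp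
    moreover have "0 \<prec> (\<chi> i::'n. \<epsilon> / 2)" using \<open>\<epsilon> > 0\<close> by (simp add: vec_less_def)
    ultimately show False
      using multiplicity_infinity_eq_0 corner by (metis cornerpoint_at_infinity_def less_numeral_extra(3))
  qed
qed

end
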